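(* Fix a mesh $\mathcal{M}$ of convex polygons $\{\mathfrak{m}\}$ in $\mathbb{R}^2$ and assign some ordering $\mathbf{v}_1,\ldots,\mathbf{v}_p$ to all the vertices in the mesh. Fix an associated set of generalized barycentric coordinate hat functions $\hat\lambda_1,\ldots,\hat\lambda_p$. Let $$\mathbf{u}\in\operatorname{span}\left\{\operatorname{rot}(\hat\lambda_i\nabla\hat\lambda_j) \;:\; \text{there exists } \mathfrak{m}\in\mathcal{M} \text{ such that } \mathbf{v}_i,\mathbf{v}_j\in\mathfrak{m}\right\}.$$ Then $\mathbf{u}\in H(\operatorname{div},\mathcal{M})$.
   Context: Mesh: $\mathcal{M}$ is a cellular complex whose 2-dimensional cells (elements) $\mathfrak{m}$ are convex polygons, meeting along edges and vertices. The vertices $\mathbf{v}_i$ of the mesh are the vertices of its elements, and $\mathbf{v}_i\in\mathfrak{m}$ means that $\mathbf{v}_i$ is a vertex of $\mathfrak{m}$; $\mathbf{v}_i$ and $\mathbf{v}_j$ need not be joined by an edge of $\mathfrak{m}$. Generalized barycentric coordinates on a convex polygon $\mathfrak{m}$ with vertices $\{\mathbf{v}_i\}$: non-negative functions $\lambda_i:\mathfrak{m}\to\mathbb{R}$, one per vertex, such that every linear function $L:\mathfrak{m}\to\mathbb{R}$ (polynomial of degree at most 1) satisfies $L=\sum_i L(\mathbf{v}_i)\lambda_i$. One such set is chosen on each element. Hat functions: for $\mathbf{x}\in\mathfrak{m}$, $\hat\lambda_i(\mathbf{x})=\lambda_i(\mathbf{x})$ (the coordinate on $\mathfrak{m}$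 associated to $\mathbf{v}_i$) if $\mathbf{v}_i\in\mathfrak{m}$, and $\hat\lambda_i(\mathbf{x})=0$ if $\mathbf{v}_i\notin\mathfrak{m}$. These are well defined on the mesh, since any choices of coordinates on neighbouring polygons agree at shared edges and vertices. The vector functions $\hat\lambda_i\nabla\hat\lambda_j$ are defined piecewise, element by element. $\operatorname{rot}\mathbf{F}=\begin{bmatrix}0&-1\\1&0\end{bmatrix}\mathbf{F}$ for a vector field $\mathbf{F}$ in $\mathbb{R}^2$; it gives an isomorphism from $H(\operatorname{curl})$ to $H(\operatorname{div})$ in $\mathbb{R}^2$, where $\operatorname{curl}(F_1,F_2)^T=\partial F_1/\partial y-\partial F_2/\partial x$ and $\operatorname{div}(F_1,F_2)^T=\partial F_1/\partial x+\partial F_2/\partial y$. $H(\operatorname{div},\mathcal{M})$ (respectively $H(\operatorname{curl},\mathcal{M})$) is the space of $L^2$ vector fields on the domain covered by $\mathcal{M}$ whose (distributional) divergence (respectively curl) is in $L^2$.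
   Formalization: Each barycentric coordinate is additionally assumed Lipschitz on its closed polygon (hence differentiable almost everywhere); without a regularity assumption the gradients may not exist or the products may fail to be square-integrable. *)

theory Defs
  imports "HOL-Analysis.Analysis" "HOL-Library.Function_Algebras"
begin

section \<open>Meshes of convex polygons\<close>

definition convex_polygon :: "(real^2) set \<Rightarrow> bool" where
  "convex_polygon m \<longleftrightarrow> polytope m \<and> aff_dim m = 2"

definition vertices :: "(real^2) set \<Rightarrow> (real^2) set" where
  "vertices m = {w. w extreme_point_of m}"

text \<open>
  A mesh is represented by the finite set of its elements, as closed subsets of the plane; the
  edges and vertices of the complex are the lower-dimensional faces of the elements. For distinct
  elements the face condition forces the intersection to be empty, a common vertex or a common
  edge.
\<close>

definition polygonal_mesh :: "(real^2) set set \<Rightarrow> bool" where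
  "polygonal_mesh M \<longleftrightarrow>
     finite M \<and>
     (\<forall>m\<in>M. convex_polygon m) \<and>
     (\<forall>m\<in>M. \<forall>n\<in>M. (m \<inter> n) face_of m \<and> (m \<inter> n) face_of n)"

definition mesh_vertices :: "(real^2) set set \<Rightarrow> (real^2) set" where
  "mesh_vertices M = (\<Union>m\<in>M. vertices m)"


section \<open>Generalized barycentric coordinates and hat functions\<close>

text \<open>
  The coordinate attached to the vertex \<open>w\<close> is \<open>l w\<close>; only its values on \<open>m\<close> matter. Polynomials of
  degree at most 1 are the functions \<open>\<lambda>y. a \<bullet> y + b\<close>.
\<close>

definition gen_barycentric :: "(real^2) set \<Rightarrow> (real^2 \<Rightarrow> real^2 \<Rightarrow> real) \<Rightarrow> bool" where
  "gen_barycentric m l \<longleftrightarrow>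
     (\<forall>w\<in>vertices m. \<forall>x\<in>m. 0 \<le> l w x) \<and>
     (\<forall>a b. \<forall>x\<in>m. a \<bullet> x + b = (\<Sum>w\<in>vertices m. (a \<bullet> w + b) * l w x))"

text \<open>
  Non-negativity and linear precision do not constrain the smoothness of a coordinate inside an
  element with more than three vertices, so the regularity that makes its gradient meaningful (and
  bounded) has to be required separately. The following is membership in \<open>W\<^sup>1\<^sup>,\<^sup>\<infinity>\<close>. By Rademacher's
  theorem the second conjunct follows from the first.
\<close>

definition lipschitz_regular_on :: "(real^2) set \<Rightarrow> (real^2 \<Rightarrow> real) \<Rightarrow> bool" where
  "lipschitz_regular_on m f \<longleftrightarrow>
     (\<exists>C. C-lipschitz_on m f) \<and>
     (AE x in lebesgue. x \<in> interior m \<longrightarrow> f differentiable (at x))"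

text \<open>
  Here \<open>lam m w\<close> is the coordinate on the element \<open>m\<close> for the vertex \<open>w\<close>. The description is unique
  on the domain covered by the mesh because the coordinates of two elements agree where the elements
  meet; values off that domain are irrelevant.
\<close>

definition hat ::
  "(real^2) set set \<Rightarrow> ((real^2) set \<Rightarrow> real^2 \<Rightarrow> real^2 \<Rightarrow> real) \<Rightarrow> real^2 \<Rightarrow> real^2 \<Rightarrow> real" where
  "hat M lam w x =
     (THE r. \<exists>m\<in>M. x \<in> m \<and> r = (if w \<in> vertices m then lam m w x else 0))"


section \<open>Vector calculus\<close>

text \<open>
  At an interior point of an element, the gradient of a hat function is the gradient of its
  restriction to that element, so \<open>grad\<close> is the elementwise gradient except on the edges of the
  mesh, a null set on which its values are immaterial.
\<close>

definition grad :: "(real^2 \<Rightarrow> real) \<Rightarrow> real^2 \<Rightarrow> real^2" where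
  "grad f x = (THE D. GDERIV f x :> D)"

definition rot :: "real^2 \<Rightarrow> real^2" where
  "rot F = (vector [vector [0, -1], vector [1, 0]] :: real^2^2) *v F"

text \<open>Linear span in the space of vector fields with pointwise operations.\<close>

definition field_span :: "(real^2 \<Rightarrow> real^2) set \<Rightarrow> (real^2 \<Rightarrow> real^2) set" where
  "field_span = module.span (\<lambda>(c::real) F x. c *\<^sub>R F x)"


section \<open>The space \<open>H(div)\<close>\<close>

primrec Ck :: "nat \<Rightarrow> (real^2 \<Rightarrow> real) \<Rightarrow> bool" where
  "Ck 0 f \<longleftrightarrow> continuous_on UNIV f"
| "Ck (Suc k) f \<longleftrightarrow>
     (\<forall>x. f differentiable (at x)) \<and> (\<forall>i. Ck k (\<lambda>x. grad f x $ i))"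

definition test_function :: "(real^2) set \<Rightarrow> (real^2 \<Rightarrow> real) \<Rightarrow> bool" where
  "test_function U \<phi> \<longleftrightarrow>
     (\<forall>k. Ck k \<phi>) \<and> compact (closure {x. \<phi> x \<noteq> 0}) \<and> closure {x. \<phi> x \<noteq> 0} \<subseteq> U"

definition L2_on :: "(real^2) set \<Rightarrow> (real^2 \<Rightarrow> 'a::euclidean_space) \<Rightarrow> bool" where
  "L2_on D F \<longleftrightarrow>
     F \<in> borel_measurable (lebesgue_on D) \<and>
     integrable (lebesgue_on D) (\<lambda>x. (norm (F x))\<^sup>2)"

definition distributional_div ::
  "(real^2) set \<Rightarrow> (real^2 \<Rightarrow> real^2) \<Rightarrow> (real^2 \<Rightarrow> real) \<Rightarrow> bool" where
  "distributional_div U F g \<longleftrightarrow>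
     (\<forall>\<phi>. test_function U \<phi> \<longrightarrow>
        (LINT x:U|lebesgue. F x \<bullet> grad \<phi> x) = - (LINT x:U|lebesgue. g x * \<phi> x))"

text \<open>
  The domain covered by the mesh is the union of its (closed) elements; distributions live on its
  interior. Members are functions rather than almost-everywhere classes.
\<close>

definition Hdiv :: "(real^2) set set \<Rightarrow> (real^2 \<Rightarrow> real^2) set" where
  "Hdiv M =
     {F. L2_on (\<Union>M) F \<and>
         (\<exists>g. L2_on (\<Union>M) g \<and> distributional_div (interior (\<Union>M)) F g)}"

end

(*
  A hat function is Lipschitz along every segment inside the mesh, because the element coordinates
  agree where elements meet: linear precision together with a supporting line makes the coordinates
  of the vertices off a face vanish on that face, and on an edge it determines the other two.

  For such functions a and b, the divergence of rot (a grad b) is grad a . rot (grad b). Testing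
  against phi and putting q = a phi, this says that the integral of rot (grad b) . grad q vanishes.
  No mollification is needed: the difference quotients satisfy
    int (b(x + s) - b(x)) (q(x - t) - q(x)) dx = int (b(x + t) - b(x)) (q(x - s) - q(x)) dx
  exactly, by translation invariance, and dominated convergence passes to the limit with s and t
  along the two axes.
*)
theory Submission
  imports Defs "HOL-Real_Asymp.Real_Asymp"
begin

section \<open>Coordinates on faces and agreement across elements\<close>

text \<open>The affine function \<open>b - a . y\<close> of a line supporting \<open>m\<close> along
  \<open>f\<close> is non-negative on \<open>m\<close> and zero at \<open>x\<close>. Linear
  precision writes that zero as a sum of non-negative terms, so each term vanishes, and the factor
  at \<open>w\<close> is nonzero because \<open>w\<close> lies off \<open>f\<close>.\<close>

lemma coord_eq_0_off_face:
  assumes "polytope m" "gen_barycentric m l" "f face_of m" "x \<in> f" "w \<in> vertices m" "w \<notin> f"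
  shows "l w x = 0"
proof -
  have "f exposed_face_of m"
    using assms exposed_face_of_polyhedron polytope_imp_polyhedron by blast
  then obtain a b where ab: "m \<subseteq> {x. a \<bullet> x \<le> b}" "f = m \<inter> {x. a \<bullet> x = b}"
    unfolding exposed_face_of_def by blast
  have xm: "x \<in> m" and ax: "a \<bullet> x = b"
    using assms(4) ab by auto
  have vm: "vertices m \<subseteq> m"
    by (auto simp: vertices_def extreme_point_of_def)
  have fin: "finite (vertices m)"
    unfolding vertices_def
    by (simp add: assms(1) finite_polyhedron_extreme_points polytope_imp_polyhedron)
  have "(- a) \<bullet> x + b = (\<Sum>y\<in>vertices m. ((- a) \<bullet> y + b) * l y x)"
    using assms(2) xm unfolding gen_barycentric_def by blast
  then have sum0: "(\<Sum>y\<in>vertices m. ((- a) \<bullet> y + b) * l y x) = 0"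
    using ax by simp
  have nonneg: "0 \<le> ((- a) \<bullet> y + b) * l y x" if "y \<in> vertices m" for y
  proof (rule mult_nonneg_nonneg)
    have "y \<in> m" using that vm by blast
    then show "0 \<le> (- a) \<bullet> y + b" using ab(1) by auto
    show "0 \<le> l y x" using that assms(2) xm unfolding gen_barycentric_def by blast
  qed
  have "((- a) \<bullet> w + b) * l w x = 0"
    by (rule sum_nonneg_0[OF fin nonneg sum0 assms(5)])
  moreover have "(- a) \<bullet> w + b \<noteq> 0"
    using assms(5,6) vm ab(2) by auto
  ultimately show ?thesis
    by simp
qed

lemma vertices_face:
  assumes "f face_of m"
  shows "vertices f = vertices m \<inter> f"
  using extreme_point_of_face[OF assms] by (auto simp: vertices_def)

text \<open>The other coordinates vanish on the edge, so linear precision involves the endpoints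
  only, and an affine function vanishing at \<open>d\<close> isolates \<open>l c x\<close>. The
  right-hand side mentions neither \<open>m\<close> nor \<open>l\<close>, which is what forces
  neighbouring elements to agree. The case \<open>c = d\<close> covers a common vertex.\<close>

lemma coord_on_edge:
  assumes "polytope m" "gen_barycentric m l" "closed_segment c d face_of m" "x \<in> closed_segment c d"
  shows "l c x = (if c = d then 1 else ((c - d) \<bullet> x - (c - d) \<bullet> d) / ((c - d) \<bullet> (c - d)))"
proof -
  have xm: "x \<in> m"
    using assms(3,4) face_of_imp_subset by blast
  have fin: "finite (vertices m)"
    unfolding vertices_def
    by (simp add: assms(1) finite_polyhedron_extreme_points polytope_imp_polyhedron)
  have sub: "{c, d} = vertices m \<inter> closed_segment c d"
    using vertices_face[OF assms(3)] by (auto simp: vertices_def extreme_point_of_segment)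
  have off: "l y x = 0" if "y \<in> vertices m - {c, d}" for y
    using coord_eq_0_off_face[OF assms(1,2,3,4)] that sub by blast
  have prec: "a \<bullet> x + b = (\<Sum>y\<in>{c, d}. (a \<bullet> y + b) * l y x)" for a b
  proof -
    have "a \<bullet> x + b = (\<Sum>y\<in>vertices m. (a \<bullet> y + b) * l y x)"
      using assms(2) xm unfolding gen_barycentric_def by blast
    also have "\<dots> = (\<Sum>y\<in>{c, d}. (a \<bullet> y + b) * l y x)"
      using off sub fin by (intro sum.mono_neutral_right) auto
    finally show ?thesis .
  qed
  show ?thesis
  proof (cases "c = d")
    case True
    \<comment> \<open>The constant function 1 is chosen: on a one-point face it leaves a single
      coordinate, which must equal 1.\<close>
    then show ?thesis using prec[of 0 1] by simp
  next
    case False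
    then have "(c - d) \<bullet> x - (c - d) \<bullet> d = ((c - d) \<bullet> (c - d)) * l c x"
      using prec[of "c - d" "- ((c - d) \<bullet> d)"] by (simp add: inner_diff_right)
    then show ?thesis using False by simp
  qed
qed

text \<open>Distinct elements meet in a segment, possibly a single point. At its endpoints
  \<open>coord_on_edge\<close> gives the same value from both sides; for any other \<open>w\<close>
  both sides are 0, either by definition or by \<open>coord_eq_0_off_face\<close>.\<close>

lemma coords_agree:
  assumes "polygonal_mesh M" "\<And>m. m \<in> M \<Longrightarrow> gen_barycentric m (lam m)"
    and "m \<in> M" "n \<in> M" "x \<in> m" "x \<in> n"
  shows "(if w \<in> vertices m then lam m w x else 0) = (if w \<in> vertices n then lam n w x else 0)"
proof (cases "m = n")
  case False
  let ?f = "m \<inter> n"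
  have pm: "polytope m" "aff_dim m = 2" and pn: "polytope n" "aff_dim n = 2"
    using assms(1,3,4) by (auto simp: polygonal_mesh_def convex_polygon_def)
  have fm: "?f face_of m" and fn: "?f face_of n"
    using assms(1,3,4) by (auto simp: polygonal_mesh_def)
  note gm = assms(2)[OF assms(3)] and gn = assms(2)[OF assms(4)]
  have xf: "x \<in> ?f" using assms by auto
  \<comment> \<open>The intersection is a proper face of at least one of the two elements, and a
    proper face of a convex set has smaller dimension.\<close>
  have "?f \<noteq> m \<or> ?f \<noteq> n" using False by auto
  then have "aff_dim ?f < 2"
    using face_of_aff_dim_lt[OF _ fm] face_of_aff_dim_lt[OF _ fn] pm pn polytope_imp_convex by metis
  then have "collinear ?f"
    by (simp add: collinear_aff_dim)
  moreover have "polytope ?f"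
    using face_of_polytope_polytope pm(1) fm by blast
  ultimately obtain c d where cd: "?f = closed_segment c d"
    using compact_convex_collinear_segment[of ?f] xf polytope_imp_compact polytope_imp_convex
    by (metis empty_iff)
  have vf: "vertices ?f = {c, d}"
    unfolding cd by (auto simp: vertices_def extreme_point_of_segment)
  show ?thesis
  proof (cases "w \<in> {c, d}")
    case True
    \<comment> \<open>The segment is reoriented so that \<open>w\<close> comes first, since
      \<open>coord_on_edge\<close> describes the coordinate of the first endpoint.\<close>
    then obtain e where e: "?f = closed_segment w e"
      using cd by (metis closed_segment_commute insertE singletonD)
    have "w \<in> vertices m" "w \<in> vertices n"
      using True vf vertices_face[OF fm] vertices_face[OF fn] by auto
    moreover have "lam m w x = lam n w x"
      using coord_on_edge[OF pm(1) gm, of w e] coord_on_edge[OF pn(1) gn, of w e] fm fn xf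
      unfolding e by simp
    ultimately show ?thesis by simp
  next
    case False
    then have "w \<notin> vertices ?f" using vf by blast
    then have "w \<in> vertices m \<Longrightarrow> w \<notin> ?f" "w \<in> vertices n \<Longrightarrow> w \<notin> ?f"
      using vertices_face[OF fm] vertices_face[OF fn] by auto
    then show ?thesis
      using coord_eq_0_off_face[OF pm(1) gm fm xf] coord_eq_0_off_face[OF pn(1) gn fn xf] by auto
  qed
qed simp

text \<open>By \<open>coords_agree\<close> all elements containing \<open>x\<close> propose the same
  value, so the definite description in \<open>hat\<close> can be evaluated on any one of
  them.\<close>

lemma hat_on_element:
  assumes "polygonal_mesh M" "\<And>m. m \<in> M \<Longrightarrow> gen_barycentric m (lam m)" "m \<in> M" "x \<in> m"
  shows "hat M lam w x = (if w \<in> vertices m then lam m w x else 0)"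
  unfolding hat_def
proof (rule the_equality)
  show "\<exists>n\<in>M. x \<in> n \<and> (if w \<in> vertices m then lam m w x else 0) = (if w \<in> vertices n then lam n w x else 0)"
    using assms by blast
next
  fix r assume "\<exists>n\<in>M. x \<in> n \<and> r = (if w \<in> vertices n then lam n w x else 0)"
  then show "r = (if w \<in> vertices m then lam m w x else 0)"
    using coords_agree[OF assms(1,2) assms(3) _ assms(4)] by metis
qed

section \<open>Gradients\<close>

lemma gderiv_unique:
  assumes "GDERIV f x :> D" "GDERIV f x :> E"
  shows "D = E"
proof -
  have "(\<lambda>h. h \<bullet> D) = (\<lambda>h. h \<bullet> E)"
    using assms has_derivative_unique unfolding gderiv_def by blast
  then have "(D - E) \<bullet> D = (D - E) \<bullet> E" by metis
  then have "(D - E) \<bullet> (D - E) = 0" by (simp only: inner_diff_right)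
  then show ?thesis by simp
qed

lemma grad_eqI: "GDERIV f x :> D \<Longrightarrow> grad f x = D"
  unfolding grad_def using gderiv_unique by blast

lemma GDERIV_grad:
  assumes "f differentiable (at x)"
  shows "GDERIV f x :> grad f x"
proof -
  obtain f' where f': "(f has_derivative f') (at x)"
    using assms unfolding differentiable_def by blast
  \<comment> \<open>The vector representing the linear functional \<open>f'\<close> is its adjoint
    applied to 1.\<close>
  then have "f' = (\<lambda>h. h \<bullet> adjoint f' 1)"
    using adjoint_works[OF has_derivative_linear[OF f'], of _ 1] by (auto simp: fun_eq_iff)
  then have "GDERIV f x :> adjoint f' 1"
    using f' unfolding gderiv_def by simp
  then show ?thesis using grad_eqI by metis
qed

section \<open>Hat functions are Lipschitz along segments in the mesh\<close>

text \<open>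
  The Lipschitz bound is required along segments inside \<open>D\<close> only, which localizes it to the single
  elements; \<open>G\<close> stands for the gradient of \<open>b\<close>.
\<close>

definition tame :: "(real^2) set \<Rightarrow> (real^2 \<Rightarrow> real) \<Rightarrow> (real^2 \<Rightarrow> real^2) \<Rightarrow> bool" where
  "tame D b G \<longleftrightarrow>
     b \<in> borel_measurable borel \<and> (\<exists>B. \<forall>x. \<bar>b x\<bar> \<le> B) \<and>
     (\<exists>C. \<forall>x y. closed_segment x y \<subseteq> D \<longrightarrow> \<bar>b x - b y\<bar> \<le> C * dist x y) \<and>
     (AE x in lebesgue. x \<in> D \<longrightarrow> x \<in> interior D \<and> GDERIV b x :> G x)"

text \<open>Parametrising the segment over the unit interval reduces the claim to gluing: the
  preimages of the elements are finitely many closed sets covering the interval, and on each the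
  composite is Lipschitz with constant \<open>C * dist x y\<close>.\<close>

lemma lipschitz_along_segments:
  fixes f :: "'a::real_normed_vector \<Rightarrow> real"
  assumes "finite M" "\<And>m. m \<in> M \<Longrightarrow> closed m" "\<And>m. m \<in> M \<Longrightarrow> C-lipschitz_on m f" "0 \<le> C"
    and seg: "closed_segment x y \<subseteq> \<Union>M"
  shows "\<bar>f x - f y\<bar> \<le> C * dist x y"
proof -
  define p where "p t = x + t *\<^sub>R (y - x)" for t
  have dp: "dist (p s) (p t) = dist s t * dist x y" for s t
    by (simp add: p_def dist_norm scaleR_diff_left[symmetric] norm_minus_commute)
  have contp: "continuous_on UNIV p"
    unfolding p_def by (intro continuous_intros)
  have "(C * dist x y)-lipschitz_on {0..1} (f \<circ> p)"
  proof (rule lipschitz_on_closed_Union)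
    show "(C * dist x y)-lipschitz_on (p -` m) (f \<circ> p)" if "m \<in> M" for m
    proof (rule lipschitz_onI)
      fix s t assume "s \<in> p -` m" "t \<in> p -` m"
      then have "dist (f (p s)) (f (p t)) \<le> C * dist (p s) (p t)"
        using assms(3)[OF that] by (auto dest: lipschitz_onD)
      then show "dist ((f \<circ> p) s) ((f \<circ> p) t) \<le> C * dist x y * dist s t"
        by (simp add: dp mult_ac)
    qed (use \<open>0 \<le> C\<close> in simp)
    show "closed (p -` m)" if "m \<in> M" for m
      using contp assms(2)[OF that] closed_vimage by (metis continuous_on_eq_continuous_at open_UNIV)
    show "{0..1} \<subseteq> (\<Union>m\<in>M. p -` m)"
    proof
      fix t :: real assume "t \<in> {0..1}"
      then have "p t \<in> closed_segment x y"
        by (auto simp: p_def closed_segment_def algebra_simps intro!: exI[of _ t])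
      then show "t \<in> (\<Union>m\<in>M. p -` m)"
        using seg by auto
    qed
  qed (use assms in auto)
  then have "dist ((f \<circ> p) 0) ((f \<circ> p) 1) \<le> C * dist x y * dist 0 (1::real)"
    by (rule lipschitz_onD) auto
  then show ?thesis
    by (simp add: p_def dist_real_def)
qed

text \<open>The hat function is cut off to 0 outside the mesh, where its own values are unspecified,
  so that it becomes Borel and bounded on the whole plane. The Lipschitz bound comes from gluing the
  elements, the differentiability from their interiors.\<close>

lemma tame_hat:
  assumes mesh: "polygonal_mesh M"
    and coords: "\<And>m. m \<in> M \<Longrightarrow> gen_barycentric m (lam m)"
    and regular: "\<And>m w. m \<in> M \<Longrightarrow> w \<in> vertices m \<Longrightarrow> lipschitz_regular_on m (lam m w)"
  shows "tame (\<Union>M) (\<lambda>x. if x \<in> \<Union>M then hat M lam w x else 0) (grad (hat M lam w))"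
proof -
  let ?D = "\<Union>M" and ?h = "hat M lam w"
  let ?b = "\<lambda>x. if x \<in> ?D then ?h x else 0"
  have finM: "finite M" and poly: "\<And>m. m \<in> M \<Longrightarrow> polytope m"
    using mesh by (auto simp: polygonal_mesh_def convex_polygon_def)
  then have comp: "\<And>m. m \<in> M \<Longrightarrow> compact m" and conv: "\<And>m. m \<in> M \<Longrightarrow> convex m"
    using polytope_imp_compact polytope_imp_convex by auto
  then have clos: "\<And>m. m \<in> M \<Longrightarrow> closed m"
    using compact_imp_closed by blast
  have compD: "compact ?D"
    using comp finM by blast
  have hat_m: "?h x = (if w \<in> vertices m then lam m w x else 0)" if "m \<in> M" "x \<in> m" for m x
    using hat_on_element[OF mesh coords that] .
  have "\<exists>C. C-lipschitz_on m ?h" if "m \<in> M" for m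
  proof (cases "w \<in> vertices m")
    case True
    then obtain C where "C-lipschitz_on m (lam m w)"
      using regular[OF \<open>m \<in> M\<close> True] unfolding lipschitz_regular_on_def by blast
    then have "C-lipschitz_on m ?h"
      using hat_m[OF that] True by (simp cong: lipschitz_on_cong)
    then show ?thesis by blast
  next
    case False
    then have "0-lipschitz_on m ?h"
      using hat_m[OF that] by (auto intro!: lipschitz_onI)
    then show ?thesis by blast
  qed
  then obtain c where c: "\<And>m. m \<in> M \<Longrightarrow> (c m)-lipschitz_on m ?h"
    by metis
  \<comment> \<open>One constant for all elements: the sum dominates each
    \<open>c m\<close>.\<close>
  define C where "C = (\<Sum>m\<in>M. \<bar>c m\<bar>)"
  have C: "C-lipschitz_on m ?h" if "m \<in> M" for m
  proof -
    have "c m \<le> \<bar>c m\<bar>" by simp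
    also have "\<dots> \<le> C"
      unfolding C_def using that finM by (intro member_le_sum) auto
    finally show ?thesis
      using lipschitz_on_mono[OF c[OF that]] by blast
  qed
  have C0: "0 \<le> C" by (simp add: C_def sum_nonneg)
  have contD: "continuous_on ?D ?h"
  proof -
    have "continuous_on (\<Union>m\<in>M. m) ?h"
      using finM clos C lipschitz_on_continuous_on by (intro continuous_on_closed_Union) blast+
    then show ?thesis by simp
  qed
  have "?b \<in> borel_measurable borel"
  proof -
    have "?D \<in> sets borel"
      using compD borel_compact by blast
    then show ?thesis
      using borel_measurable_continuous_on_if[OF _ contD, of "\<lambda>x. 0"] by simp
  qed
  moreover have "\<exists>B. \<forall>x. \<bar>?b x\<bar> \<le> B"
  proof -
    have "bounded (?h ` ?D)"
      using compact_continuous_image[OF contD compD] compact_imp_bounded by blast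
    then obtain B where "0 < B" "\<And>x. x \<in> ?D \<Longrightarrow> \<bar>?h x\<bar> \<le> B"
      unfolding bounded_pos by auto
    then show ?thesis by (auto intro!: exI[of _ B])
  qed
  moreover have "\<bar>?b x - ?b y\<bar> \<le> C * dist x y" if "closed_segment x y \<subseteq> ?D" for x y
  proof -
    have "x \<in> ?D" "y \<in> ?D" using that by auto
    then show ?thesis
      using lipschitz_along_segments[OF finM clos C C0 that] by (simp del: Union_iff)
  qed
  moreover have "AE x in lebesgue. x \<in> ?D \<longrightarrow> x \<in> interior ?D \<and> GDERIV ?b x :> grad ?h x"
  proof -
    \<comment> \<open>Frontiers of convex sets are null sets and there are finitely many elements,
      so almost every point of the mesh is interior to an element.\<close>
    have "AE x in lebesgue. \<forall>m\<in>M. x \<notin> frontier m"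
    proof (rule AE_finite_allI[OF finM])
      fix m assume "m \<in> M"
      then have "frontier m \<in> null_sets lebesgue"
        using negligible_convex_frontier[OF conv] negligible_iff_null_sets by blast
      then show "AE x in lebesgue. x \<notin> frontier m"
        by (rule AE_not_in)
    qed
    moreover have "AE x in lebesgue. \<forall>m\<in>M. w \<in> vertices m \<longrightarrow> x \<in> interior m \<longrightarrow> lam m w differentiable (at x)"
      using regular unfolding lipschitz_regular_on_def
      by (intro AE_finite_allI[OF finM]) (metis (mono_tags, lifting) AE_I2 AE_mp)
    ultimately show ?thesis
    proof eventually_elim
      case (elim x)
      show ?case
      proof
        assume "x \<in> ?D"
        then obtain m where m: "m \<in> M" "x \<in> m" by blast
        then have xi: "x \<in> interior m"
          using elim(1) by (auto simp: frontier_def closure_closed clos)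
        have "interior m \<subseteq> interior ?D"
          using m by (intro interior_mono) auto
        have "(\<lambda>x. if w \<in> vertices m then lam m w x else 0) differentiable (at x)"
          using elim(2) m xi by (cases "w \<in> vertices m") auto
        then obtain f' where f': "((\<lambda>x. if w \<in> vertices m then lam m w x else 0) has_derivative f') (at x)"
          unfolding differentiable_def by blast
        \<comment> \<open>On the open set \<open>interior m\<close> the hat function equals its
          formula on \<open>m\<close>, so the derivative carries over.\<close>
        have "(?h has_derivative f') (at x)"
          by (rule has_derivative_transform_within_open[OF f' open_interior xi])
            (use hat_m[OF m(1)] interior_subset in fastforce)
        then have *: "GDERIV ?h x :> grad ?h x"
          using GDERIV_grad unfolding differentiable_def by blast
        have "GDERIV ?b x :> grad ?h x"
          unfolding gderiv_def
          by (rule has_derivative_transform_within_open[OF *[unfolded gderiv_def] open_interior xi])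
            (use m interior_subset in fastforce)
        then show "x \<in> interior ?D \<and> GDERIV ?b x :> grad ?h x"
          using xi \<open>interior m \<subseteq> interior ?D\<close> by blast
      qed
    qed
  qed
  ultimately show ?thesis
    unfolding tame_def by blast
qed

section \<open>Translation invariance and exchange of difference steps\<close>

lemma lborel_integral_translate:
  fixes f :: "'a::euclidean_space \<Rightarrow> real"
  assumes "f \<in> borel_measurable borel"
  shows "(\<integral>x. f (x + c) \<partial>lborel) = (\<integral>x. f x \<partial>lborel)"
proof -
  have "(\<integral>x. f x \<partial>distr lborel borel ((+) c)) = (\<integral>x. f (c + x) \<partial>lborel)"
    using assms by (intro integral_distr) auto
  then show ?thesis
    by (simp add: lborel_distr_plus add.commute)
qed

lemma lborel_integrable_translate:
  fixes f :: "'a::euclidean_space \<Rightarrow> real"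
  assumes "integrable lborel f"
  shows "integrable lborel (\<lambda>x. f (x + c))"
proof -
  have "integrable (distr lborel borel ((+) c)) f"
    using assms by (simp add: lborel_distr_plus)
  moreover have "f \<in> borel_measurable borel"
    using borel_measurable_integrable[OF assms] by simp
  ultimately have "integrable lborel (\<lambda>x. f (c + x))"
    by (subst (asm) integrable_distr_eq) auto
  then show ?thesis
    by (simp add: add.commute)
qed

text \<open>Expanding gives four integrals of a translate of \<open>b\<close> against a translate of
  \<open>q\<close>. Each depends only on the difference of the two shifts, and the resulting
  combination is symmetric in \<open>s\<close> and \<open>t\<close>. This is a discrete form of the
  symmetry of second derivatives.\<close>

lemma difference_product_swap:
  fixes b q :: "'a::euclidean_space \<Rightarrow> real"
  assumes b: "b \<in> borel_measurable borel" "\<And>x. \<bar>b x\<bar> \<le> B" and q: "integrable lborel q"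
  shows "integrable lborel (\<lambda>x. (b (x + s) - b x) * (q (x - t) - q x))" (is ?int)
    and "(\<integral>x. (b (x + s) - b x) * (q (x - t) - q x) \<partial>lborel)
       = (\<integral>x. (b (x + t) - b x) * (q (x - s) - q x) \<partial>lborel)" (is ?eq)
proof -
  note [measurable] = b(1) 
  have q'[measurable]: "q \<in> borel_measurable borel"
    using borel_measurable_integrable[OF q] by simp
  define I where "I u w = (\<integral>x. b (x + u) * q (x + w) \<partial>lborel)" for u w
  have int: "integrable lborel (\<lambda>x. b (x + u) * q (x + w))" for u w
  proof (rule Bochner_Integration.integrable_bound)
    show "integrable lborel (\<lambda>x. B * q (x + w))"
      using lborel_integrable_translate[OF q] by simp
    show "(\<lambda>x. b (x + u) * q (x + w)) \<in> borel_measurable lborel"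
      by measurable
    have "0 \<le> B" using b(2)[of 0] by linarith
    then show "AE x in lborel. norm (b (x + u) * q (x + w)) \<le> norm (B * q (x + w))"
      using b(2) by (auto simp: abs_mult intro!: mult_right_mono)
  qed
  have I: "I u w = I (u - w) 0" for u w
  proof -
    have "(\<integral>x. b (x + (u - w)) * q x \<partial>lborel) = (\<integral>x. b (x + w + (u - w)) * q (x + w) \<partial>lborel)"
      by (rule lborel_integral_translate[symmetric]) measurable
    then show ?thesis by (simp add: I_def algebra_simps)
  qed
  have expand: "(b (x + s) - b x) * (q (x - t) - q x) =
      b (x + s) * q (x + - t) - b (x + s) * q (x + 0) - b (x + 0) * q (x + - t) + b (x + 0) * q (x + 0)" for s t x
    by (simp add: algebra_simps)
  show ?int
    unfolding expand using int by (intro Bochner_Integration.integrable_add Bochner_Integration.integrable_diff)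
  have *: "(\<integral>x. (b (x + s) - b x) * (q (x - t) - q x) \<partial>lborel) = I s (- t) - I s 0 - I 0 (- t) + I 0 0" for s t
    unfolding expand I_def using int
    by (simp only: Bochner_Integration.integral_add Bochner_Integration.integral_diff
        Bochner_Integration.integrable_add Bochner_Integration.integrable_diff)
  show ?eq
    \<comment> \<open>Both sides reduce to
      \<open>I (s + t) 0 - I s 0 - I t 0 + I 0 0\<close>.\<close>
    unfolding * using I[of s "- t"] I[of t "- s"] I[of 0 "- t"] I[of 0 "- s"] by (simp add: add.commute)
qed

section \<open>Difference quotients and the divergence of a rotated gradient\<close>

text \<open>Restricting \<open>f\<close> to the line through \<open>x\<close> along \<open>e\<close>
  turns this into an ordinary derivative. Since \<open>e\<close> is arbitrary, \<open>- e\<close>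
  yields the backward differences used for \<open>q\<close>.\<close>

lemma GDERIV_difference_quotient:
  assumes "GDERIV f x :> D" "h \<longlonglongrightarrow> 0" "\<And>n. h n \<noteq> 0"
  shows "(\<lambda>n. (f (x + h n *\<^sub>R e) - f x) / h n) \<longlonglongrightarrow> e \<bullet> D"
proof -
  have *: "(f has_derivative (\<lambda>h. h \<bullet> D)) (at (x + 0 *\<^sub>R e))"
    using assms(1) by (simp add: gderiv_def)
  have "((\<lambda>t. f (x + t *\<^sub>R e)) has_derivative (\<lambda>t. (t *\<^sub>R e) \<bullet> D)) (at 0)"
    by (rule has_derivative_compose[of "\<lambda>t. x + t *\<^sub>R e", OF _ *]) (auto intro!: derivative_eq_intros)
  then have "((\<lambda>t. f (x + t *\<^sub>R e)) has_real_derivative (e \<bullet> D)) (at 0)"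
    by (simp add: has_field_derivative_def mult_commute_abs)
  then have "(\<lambda>t. (f (x + t *\<^sub>R e) - f x) / t) \<midarrow>0\<rightarrow> e \<bullet> D"
    by (simp add: DERIV_def)
  moreover have "filterlim h (at 0) sequentially"
    using assms(2,3) by (simp add: filterlim_at)
  ultimately show ?thesis
    by (rule filterlim_compose)
qed

lemma rot_inner: "rot F \<bullet> G = F $ 1 * G $ 2 - F $ 2 * G $ 1"
  by (simp add: rot_def matrix_vector_mult_def inner_vec_def sum_2)

text \<open>The weak form of \<open>div (rot (grad b)) = 0\<close>, tested against a merely
  Lipschitz \<open>q\<close>. The discrete fields \<open>s n\<close> integrate to exactly 0 by
  \<open>difference_product_swap\<close>, are dominated uniformly, and converge almost everywhere to
  the negated integrand.\<close>

lemma wedge_integral_eq_0: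
  fixes b q :: "real^2 \<Rightarrow> real"
  assumes b: "b \<in> borel_measurable borel" "\<And>x. \<bar>b x\<bar> \<le> B"
    and q: "q \<in> borel_measurable borel" "\<And>x. \<bar>q x\<bar> \<le> Q"
    and K: "compact K" "K \<subseteq> U" "open U" "\<And>x. x \<notin> K \<Longrightarrow> q x = 0"
    and lipb: "0 \<le> C" "\<And>x y. closed_segment x y \<subseteq> U \<Longrightarrow> \<bar>b x - b y\<bar> \<le> C * dist x y"
    and lipq: "0 \<le> C'" "\<And>x y. closed_segment x y \<subseteq> U \<Longrightarrow> \<bar>q x - q y\<bar> \<le> C' * dist x y"
    and diff: "AE x in lebesgue. x \<in> U \<longrightarrow> GDERIV b x :> Gb x \<and> GDERIV q x :> Gq x"
  shows "(\<integral>x. indicator U x * (rot (Gb x) \<bullet> Gq x) \<partial>lebesgue) = 0"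
proof -
  note [measurable] = b(1) q(1)
  obtain \<delta> where \<delta>: "\<delta> > 0" "(\<Union>x\<in>K. ball x \<delta>) \<subseteq> U"
    using compact_subset_open_imp_ball_epsilon_subset[OF K(1,3,2)] .
  obtain R where R: "\<And>x. x \<in> K \<Longrightarrow> norm x \<le> R"
    using compact_imp_bounded[OF K(1)] unfolding bounded_iff by blast
  have intq: "integrable lborel q"
  proof (rule Bochner_Integration.integrable_bound)
    show "integrable lborel (\<lambda>x. Q * indicator K x)"
      using K(1) by (intro integrable_mult_right integrable_real_indicator)
        (use emeasure_compact_finite[OF K(1)] in \<open>auto simp: borel_compact\<close>)
    show "AE x in lborel. norm (q x) \<le> norm (Q * indicator K x)"
      using q(2) K(4) by (intro AE_I2) (auto simp: indicator_def intro: order_trans[OF _ abs_ge_self])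
  qed measurable
  \<comment> \<open>The factor 3 gives \<open>2 * h n < \<delta>\<close>: two steps starting from a
    point of \<open>K\<close> stay inside a ball contained in \<open>U\<close>.\<close>
  define h where "h n = \<delta> / (3 * (real n + 1))" for n
  have h: "0 < h n" "2 * h n < \<delta>" for n
    using \<delta>(1) by (auto simp: h_def field_simps intro: add_strict_increasing)
  have h_nz: "h n \<noteq> 0" for n
    using h(1)[of n] by simp
  have h0: "h \<longlonglongrightarrow> 0"
    unfolding h_def by real_asymp
  define e where "e i = (axis i 1 :: real^2)" for i
  \<comment> \<open>A forward difference of \<open>b\<close> along axis \<open>i\<close> times a
    backward difference of \<open>q\<close> along axis \<open>j\<close>; exchanging the axes does
    not change the integral.\<close>
  define P where "P i j n x = (b (x + h n *\<^sub>R e i) - b x) * (q (x - h n *\<^sub>R e j) - q x)" for i j n x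
  define s where "s n x = (P 1 2 n x - P 2 1 n x) / (h n)\<^sup>2" for n x
  have norm_e: "norm (h n *\<^sub>R e i) = h n" for n i
    using h(1)[of n] by (simp add: e_def)
  have s_meas: "s n \<in> borel_measurable borel" for n
    unfolding s_def P_def by measurable
  have int_s: "integral\<^sup>L lebesgue (s n) = 0" for n
  proof -
    have "integral\<^sup>L lebesgue (s n) = integral\<^sup>L lborel (s n)"
      by (rule integral_completion) (use s_meas in simp)
    also have "\<dots> = ((\<integral>x. P 1 2 n x \<partial>lborel) - (\<integral>x. P 2 1 n x \<partial>lborel)) / (h n)\<^sup>2"
      unfolding s_def using difference_product_swap(1)[OF b intq]
      by (simp add: P_def)
    also have "\<dots> = 0"
      unfolding P_def using difference_product_swap(2)[OF b intq] by simp
    finally show ?thesis .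
  qed
  define w where "w x = 2 * (C * C') * indicator (cball 0 (R + \<delta>)) x" for x :: "real^2"
  have P_bound: "\<bar>P i j n x\<bar> \<le> C * C' * indicator (cball 0 (R + \<delta>)) x * (h n)\<^sup>2" for i j n x
  \<comment> \<open>If neither point is in \<open>K\<close>, the difference of \<open>q\<close>
    vanishes. Otherwise a point \<open>z\<close> of \<open>K\<close> lies within one step of
    \<open>x\<close>, all points involved lie in \<open>ball z \<delta>\<close>, and the Lipschitz
    bounds apply along segments in that ball.\<close>
  proof (cases "x \<in> K \<or> x - h n *\<^sub>R e j \<in> K")
    case False
    then show ?thesis using K(4) lipb(1) lipq(1) by (simp add: P_def)
  next
    case True
    define z where "z = (if x \<in> K then x else x - h n *\<^sub>R e j)"
    have dx: "dist x (x + h n *\<^sub>R e i) = h n" "dist (x - h n *\<^sub>R e j) x = h n"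
      using norm_e[of n i] norm_e[of n j] by (simp_all only: dist_norm) simp_all
    have z: "z \<in> K" "dist z x \<le> h n"
      using True h(1)[of n] dx(2) by (auto simp: z_def)
    have "x \<in> ball z \<delta>" "x + h n *\<^sub>R e i \<in> ball z \<delta>" "x - h n *\<^sub>R e j \<in> ball z \<delta>"
      using z(2) h[of n] dx dist_triangle[of z "x + h n *\<^sub>R e i" x] dist_triangle[of z "x - h n *\<^sub>R e j" x]
      by (auto simp: dist_commute)
    moreover have "ball z \<delta> \<subseteq> U"
      using \<delta>(2) z(1) by blast
    ultimately have "closed_segment (x + h n *\<^sub>R e i) x \<subseteq> U" "closed_segment (x - h n *\<^sub>R e j) x \<subseteq> U"
      by (meson closed_segment_subset convex_ball order_trans)+
    then have "\<bar>b (x + h n *\<^sub>R e i) - b x\<bar> \<le> C * h n" "\<bar>q (x - h n *\<^sub>R e j) - q x\<bar> \<le> C' * h n"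
      using lipb(2) lipq(2) dx by (metis dist_commute)+
    then have "\<bar>P i j n x\<bar> \<le> (C * h n) * (C' * h n)"
      unfolding P_def abs_mult by (intro mult_mono) auto
    moreover have "x \<in> cball 0 (R + \<delta>)"
    proof -
      have "norm x \<le> norm z + dist z x"
        by (metis dist_commute dist_norm norm_triangle_sub)
      then show ?thesis using R[OF z(1)] z(2) h[of n] by simp
    qed
    ultimately show ?thesis by (simp add: power2_eq_square mult_ac)
  qed
  have bound: "norm (s n x) \<le> w x" for n x
  proof -
    have "norm (s n x) = \<bar>P 1 2 n x - P 2 1 n x\<bar> / (h n)\<^sup>2"
      by (simp add: s_def)
    also have "\<dots> \<le> (\<bar>P 1 2 n x\<bar> + \<bar>P 2 1 n x\<bar>) / (h n)\<^sup>2"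
      by (intro divide_right_mono) auto
    also have "\<dots> \<le> w x * (h n)\<^sup>2 / (h n)\<^sup>2"
      using P_bound[of 1 2 n x] P_bound[of 2 1 n x]
      by (intro divide_right_mono) (auto simp: w_def algebra_simps)
    also have "\<dots> = w x"
      using h(1)[of n] by simp
    finally show ?thesis .
  qed
  \<comment> \<open>The minus sign comes from the backward differences of \<open>q\<close>.\<close>
  let ?f = "\<lambda>x. - (indicator U x * (rot (Gb x) \<bullet> Gq x))"
  have lim: "AE x in lebesgue. (\<lambda>n. s n x) \<longlonglongrightarrow> ?f x"
    using diff
  proof eventually_elim
    case (elim x)
    show ?case
    proof (cases "x \<in> U")
      case True
      then have "GDERIV b x :> Gb x" "GDERIV q x :> Gq x"
        using elim by auto
      then have "(\<lambda>n. (b (x + h n *\<^sub>R e i) - b x) / h n) \<longlonglongrightarrow> e i \<bullet> Gb x"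
        "(\<lambda>n. (q (x + h n *\<^sub>R (- e i)) - q x) / h n) \<longlonglongrightarrow> (- e i) \<bullet> Gq x" for i
        by (blast intro: GDERIV_difference_quotient[OF _ h0 h_nz])+
      then have "(\<lambda>n. ((b (x + h n *\<^sub>R e 1) - b x) / h n) * ((q (x + h n *\<^sub>R (- e 2)) - q x) / h n)
           - ((b (x + h n *\<^sub>R e 2) - b x) / h n) * ((q (x + h n *\<^sub>R (- e 1)) - q x) / h n))
         \<longlonglongrightarrow> (e 1 \<bullet> Gb x) * ((- e 2) \<bullet> Gq x) - (e 2 \<bullet> Gb x) * ((- e 1) \<bullet> Gq x)"
        by (intro tendsto_intros)
      moreover have "(e 1 \<bullet> Gb x) * ((- e 2) \<bullet> Gq x) - (e 2 \<bullet> Gb x) * ((- e 1) \<bullet> Gq x) = ?f x"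
        using True by (simp add: e_def rot_inner inner_axis')
      moreover have "((b (x + h n *\<^sub>R e 1) - b x) / h n) * ((q (x + h n *\<^sub>R (- e 2)) - q x) / h n)
          - ((b (x + h n *\<^sub>R e 2) - b x) / h n) * ((q (x + h n *\<^sub>R (- e 1)) - q x) / h n) = s n x" for n
        by (simp only: s_def P_def times_divide_times_eq diff_divide_distrib[symmetric] power2_eq_square
            scaleR_minus_right add_uminus_conv_diff)
      ultimately show ?thesis
        by (simp only:)
    next
      case False
      \<comment> \<open>Nothing is known about derivatives outside \<open>U\<close>, but there
        \<open>x\<close> has positive distance from \<open>K\<close>, so both differences of
        \<open>q\<close> vanish for all large \<open>n\<close>.\<close>
      have "x \<in> - K" using False K(2) by blast
      moreover have "open (- K)" using K(1) compact_imp_closed by blast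
      ultimately have "eventually (\<lambda>n. x - h n *\<^sub>R e i \<in> - K) sequentially" for i
      proof -
        have "(\<lambda>n. x - h n *\<^sub>R e i) \<longlonglongrightarrow> x - 0 *\<^sub>R e i"
          by (intro tendsto_intros h0)
        then show ?thesis
          using topological_tendstoD \<open>open (- K)\<close> \<open>x \<in> - K\<close> by fastforce
      qed
      from this[of 1] this[of 2] have "eventually (\<lambda>n. 0 = s n x) sequentially"
        by eventually_elim (use \<open>x \<in> - K\<close> K(4) in \<open>auto simp: s_def P_def\<close>)
      then have "(\<lambda>n. s n x) \<longlonglongrightarrow> 0"
        by (rule Lim_transform_eventually[OF tendsto_const])
      then show ?thesis
        using False by simp
    qed
  qed
  have "(\<lambda>n. integral\<^sup>L lebesgue (s n)) \<longlonglongrightarrow> integral\<^sup>L lebesgue ?f"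
  proof (rule integral_dominated_convergence)
    show s_leb: "s n \<in> borel_measurable lebesgue" for n
      using s_meas[of n] by (simp add: measurable_completion)
    show "integrable lebesgue w"
      unfolding w_def using lmeasurable_cball
      by (intro integrable_mult_right integrable_real_indicator) (auto simp: fmeasurable_def)
    show "AE x in lebesgue. (\<lambda>n. s n x) \<longlonglongrightarrow> ?f x" by (rule lim)
    show "AE x in lebesgue. norm (s n x) \<le> w x" for n using bound by simp
    show "?f \<in> borel_measurable lebesgue"
    \<comment> \<open>The gradients are not assumed measurable; the integrand inherits measurability
      as an almost everywhere limit.\<close>
    proof (rule borel_measurable_AE)
      show "(\<lambda>x. lim (\<lambda>n. s n x)) \<in> borel_measurable lebesgue"
        using s_leb by (rule borel_measurable_lim_metric)
      show "AE x in lebesgue. lim (\<lambda>n. s n x) = ?f x"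
        using lim by eventually_elim (rule limI)
    qed
  qed
  then have "integral\<^sup>L lebesgue ?f = 0"
    by (simp only: int_s LIMSEQ_const_iff)
  then show ?thesis by simp
qed

section \<open>Rotation and test functions\<close>

lemma rot_component: "rot F $ 1 = - F $ 2" "rot F $ 2 = F $ 1"
  by (simp_all add: rot_def matrix_vector_mult_def sum_2)

lemma linear_rot: "linear rot"
  unfolding rot_def by (rule matrix_vector_mul_linear)

lemma norm_rot: "norm (rot F) = norm F"
  by (simp add: norm_vec_def L2_set_def sum_2 rot_component add.commute)

lemma test_function_bounds:
  assumes "test_function U \<phi>"
  obtains L where "0 \<le> L" "\<And>x. \<bar>\<phi> x\<bar> \<le> L" "\<And>x. norm (grad \<phi> x) \<le> L"
    "\<And>x y. \<bar>\<phi> x - \<phi> y\<bar> \<le> L * dist x y"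
    "continuous_on UNIV \<phi>" "continuous_on UNIV (grad \<phi>)" "\<And>x. GDERIV \<phi> x :> grad \<phi> x"
proof -
  let ?K = "closure {x. \<phi> x \<noteq> 0}"
  have K: "compact ?K" and Ck: "\<And>k. Ck k \<phi>"
    using assms unfolding test_function_def by auto
  have cont: "continuous_on UNIV \<phi>"
    using Ck[of 0] by simp
  have gd: "GDERIV \<phi> x :> grad \<phi> x" for x
    using Ck[of "Suc 0"] by (auto intro: GDERIV_grad)
  have cg: "continuous_on UNIV (grad \<phi>)"
  proof -
    have "continuous_on UNIV (\<lambda>x. \<chi> i. grad \<phi> x $ i)"
      using Ck[of "Suc 0"] by (intro continuous_on_vec_lambda) simp
    then show ?thesis by simp
  qed
  have off: "\<phi> x = 0" if "x \<notin> ?K" for x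
    using that closure_subset[of "{x. \<phi> x \<noteq> 0}"] by blast
  \<comment> \<open>The complement of the closed support is open and \<open>\<phi>\<close> is zero
    on it, hence so is the gradient.\<close>
  have offg: "grad \<phi> x = 0" if "x \<notin> ?K" for x
  proof (rule grad_eqI)
    show "GDERIV \<phi> x :> 0"
      unfolding gderiv_def
    proof (rule has_derivative_transform_within_open)
      show "((\<lambda>x. 0) has_derivative (\<lambda>h. h \<bullet> 0)) (at x)" by simp
      show "open (- ?K)" by (rule open_Compl[OF closed_closure])
      show "x \<in> - ?K" using that by blast
      show "0 = \<phi> y" if "y \<in> - ?K" for y using off[of y] that by (metis ComplD)
    qed
  qed
  have "bounded (\<phi> ` ?K)" "bounded (grad \<phi> ` ?K)"
    using compact_continuous_image[OF continuous_on_subset[OF cont subset_UNIV] K]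
      compact_continuous_image[OF continuous_on_subset[OF cg subset_UNIV] K] compact_imp_bounded by blast+
  then obtain A B where A: "A > 0" "\<forall>y\<in>\<phi> ` ?K. norm y \<le> A"
    and B: "B > 0" "\<forall>y\<in>grad \<phi> ` ?K. norm y \<le> B"
    unfolding bounded_pos by blast
  \<comment> \<open>A single bound for \<open>\<phi>\<close> and its gradient; by the mean value
    inequality it is also a Lipschitz constant.\<close>
  define L where "L = max A B"
  have L: "0 \<le> L" "A \<le> L" "B \<le> L"
    using A(1) by (auto simp: L_def)
  have 1: "\<bar>\<phi> x\<bar> \<le> L" for x
  proof (cases "x \<in> ?K")
    case True
    then have "norm (\<phi> x) \<le> A" using A(2) by blast
    then show ?thesis using L by simp
  qed (use off[of x] L in linarith)
  have 2: "norm (grad \<phi> x) \<le> L" for x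
  proof (cases "x \<in> ?K")
    case True
    then have "norm (grad \<phi> x) \<le> B" using B(2) by blast
    then show ?thesis using L by simp
  next
    case False
    show ?thesis unfolding offg[OF False] using L by simp
  qed
  have 3: "\<bar>\<phi> x - \<phi> y\<bar> \<le> L * dist x y" for x y
  proof -
    have "norm (\<phi> x - \<phi> y) \<le> L * norm (x - y)"
    proof (rule differentiable_bound[OF convex_UNIV])
      show "(\<phi> has_derivative (\<lambda>h. h \<bullet> grad \<phi> x)) (at x within UNIV)" for x
        using gd by (simp add: gderiv_def)
      show "onorm (\<lambda>h. h \<bullet> grad \<phi> x) \<le> L" for x
      proof (rule onorm_le)
        fix h
        have "norm (h \<bullet> grad \<phi> x) \<le> norm h * norm (grad \<phi> x)"
          by (simp add: Cauchy_Schwarz_ineq2)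
        also have "\<dots> \<le> norm h * L"
          using 2 by (simp add: mult_left_mono)
        finally show "norm (h \<bullet> grad \<phi> x) \<le> L * norm h"
          by (simp add: mult.commute)
      qed
    qed auto
    then show ?thesis by (simp add: dist_norm)
  qed
  show ?thesis
    using that L(1) 1 2 3 cont cg gd by blast
qed

section \<open>Essentially bounded functions on the domain\<close>

text \<open>The space \<open>L^\<infinity>\<close>. It is stable under the products occurring here,
  and on a compact domain it supplies both square integrability and the integrability needed to
  split integrals.\<close>

definition ess_bounded_on :: "(real^2) set \<Rightarrow> (real^2 \<Rightarrow> 'a::euclidean_space) \<Rightarrow> bool" where
  "ess_bounded_on D F \<longleftrightarrow>
     F \<in> borel_measurable (lebesgue_on D) \<and> (\<exists>B. AE x in lebesgue_on D. norm (F x) \<le> B)"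

lemma ess_bounded_on_add:
  assumes "ess_bounded_on D F" "ess_bounded_on D G"
  shows "ess_bounded_on D (\<lambda>x. F x + G x)"
proof -
  obtain A B where "AE x in lebesgue_on D. norm (F x) \<le> A" "AE x in lebesgue_on D. norm (G x) \<le> B"
    using assms unfolding ess_bounded_on_def by blast
  then have "AE x in lebesgue_on D. norm (F x + G x) \<le> A + B"
    by eventually_elim (rule norm_add_rule_thm)
  then show ?thesis
    using assms unfolding ess_bounded_on_def by (blast intro: borel_measurable_add)
qed

lemma ess_bounded_on_inner:
  assumes "ess_bounded_on D F" "ess_bounded_on D G"
  shows "ess_bounded_on D (\<lambda>x. F x \<bullet> G x)"
proof -
  obtain A B where "AE x in lebesgue_on D. norm (F x) \<le> A" "AE x in lebesgue_on D. norm (G x) \<le> B"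
    using assms unfolding ess_bounded_on_def by blast
  then have "AE x in lebesgue_on D. norm (F x \<bullet> G x) \<le> A * B"
  proof eventually_elim
    case (elim x)
    have "norm (F x \<bullet> G x) \<le> norm (F x) * norm (G x)"
      by (simp add: Cauchy_Schwarz_ineq2)
    also have "\<dots> \<le> A * B"
      using elim order_trans[OF norm_ge_zero elim(1)] by (intro mult_mono) auto
    finally show ?case .
  qed
  then show ?thesis
    using assms unfolding ess_bounded_on_def by (blast intro: borel_measurable_inner)
qed

lemma ess_bounded_on_scaleR:
  assumes "ess_bounded_on D f" "ess_bounded_on D G"
  shows "ess_bounded_on D (\<lambda>x. f x *\<^sub>R G x)"
proof -
  obtain A B where "AE x in lebesgue_on D. norm (f x) \<le> A" "AE x in lebesgue_on D. norm (G x) \<le> B"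
    using assms unfolding ess_bounded_on_def by blast
  then have "AE x in lebesgue_on D. norm (f x *\<^sub>R G x) \<le> A * B"
  proof eventually_elim
    case (elim x)
    then show ?case
      using order_trans[OF norm_ge_zero elim(1)]
      unfolding norm_scaleR real_norm_def by (intro mult_mono) auto
  qed
  then show ?thesis
    using assms unfolding ess_bounded_on_def by (blast intro: borel_measurable_scaleR)
qed

lemma ess_bounded_on_const: "ess_bounded_on D (\<lambda>x. c)"
  unfolding ess_bounded_on_def by (auto intro!: exI[of _ "norm c"])

lemma ess_bounded_on_rot:
  assumes "ess_bounded_on D F"
  shows "ess_bounded_on D (\<lambda>x. rot (F x))"
proof -
  have "bounded_linear rot"
    using linear_rot linear_conv_bounded_linear by blast
  then have "rot \<in> borel_measurable borel"
    by (intro borel_measurable_continuous_onI linear_continuous_on)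
  then have "(\<lambda>x. rot (F x)) \<in> borel_measurable (lebesgue_on D)"
    using assms unfolding ess_bounded_on_def by (intro measurable_compose[OF _ \<open>rot \<in> _\<close>]) blast
  then show ?thesis
    using assms by (simp add: ess_bounded_on_def norm_rot)
qed

lemma ess_bounded_on_cong:
  assumes "\<And>x. x \<in> D \<Longrightarrow> F x = G x"
  shows "ess_bounded_on D F \<longleftrightarrow> ess_bounded_on D G"
proof -
  have "F \<in> borel_measurable (lebesgue_on D) \<longleftrightarrow> G \<in> borel_measurable (lebesgue_on D)"
    using assms by (intro measurable_cong) simp
  moreover have "(AE x in lebesgue_on D. norm (F x) \<le> B) \<longleftrightarrow> (AE x in lebesgue_on D. norm (G x) \<le> B)" for B
    using assms by (intro AE_cong) simp
  ultimately show ?thesis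
    unfolding ess_bounded_on_def by simp
qed

lemma ess_bounded_on_integrable:
  assumes "compact D" "ess_bounded_on D F"
  shows "integrable (lebesgue_on D) F"
  using assms finite_measure.integrable_const_bound[OF finite_measure_lebesgue_on[OF lmeasurable_compact]]
  unfolding ess_bounded_on_def by blast

lemma ess_bounded_on_imp_L2:
  assumes "compact D" "ess_bounded_on D F"
  shows "L2_on D F"
proof -
  have "ess_bounded_on D (\<lambda>x. (norm (F x))\<^sup>2)"
    using ess_bounded_on_inner[OF assms(2) assms(2)] by (simp add: dot_square_norm)
  then show ?thesis
    using assms ess_bounded_on_integrable unfolding L2_on_def ess_bounded_on_def by blast
qed

lemma ess_bounded_on_set_integrable:
  assumes "compact D" "ess_bounded_on D F"
  shows "set_integrable lebesgue (interior D) F"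
proof -
  have "set_integrable lebesgue D F"
    using ess_bounded_on_integrable[OF assms] assms(1)
    unfolding set_integrable_def by (subst (asm) integrable_restrict_space) (auto intro: lmeasurable_compact fmeasurableD)
  then show ?thesis
    by (rule set_integrable_subset) (auto simp: interior_subset)
qed

lemma ess_bounded_on_test_function:
  assumes "test_function U \<phi>"
  shows "ess_bounded_on D \<phi>" "ess_bounded_on D (grad \<phi>)"
proof -
  obtain L where L: "\<And>x. \<bar>\<phi> x\<bar> \<le> L" "\<And>x. norm (grad \<phi> x) \<le> L"
    "continuous_on UNIV \<phi>" "continuous_on UNIV (grad \<phi>)"
    using test_function_bounds[OF assms] by metis
  have "\<phi> \<in> borel_measurable (lebesgue_on D)" "grad \<phi> \<in> borel_measurable (lebesgue_on D)"
    using L(3,4) by (auto intro!: measurable_restrict_space1 measurable_completion simp: borel_measurable_continuous_onI)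
  then show "ess_bounded_on D \<phi>" "ess_bounded_on D (grad \<phi>)"
    using L(1,2) by (auto simp: ess_bounded_on_def)
qed

section \<open>Gradients of tame functions and weak divergence of products\<close>

text \<open>Difference quotients give both properties of \<open>G\<close>: it is their limit almost
  everywhere on \<open>D\<close>, hence measurable, and near an interior point the short segments
  stay in \<open>D\<close>, so every component is bounded by the Lipschitz constant.\<close>

lemma tame_imp_ess_bounded:
  assumes "tame D b G" "compact D"
  shows "ess_bounded_on D b" "ess_bounded_on D G"
proof -
  have D: "D \<in> sets lebesgue"
    using assms(2) by (simp add: lmeasurable_compact fmeasurableD)
  obtain B C where b: "b \<in> borel_measurable borel" "\<And>x. \<bar>b x\<bar> \<le> B"
    and C: "\<And>x y. closed_segment x y \<subseteq> D \<Longrightarrow> \<bar>b x - b y\<bar> \<le> C * dist x y"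
    and AE: "AE x in lebesgue. x \<in> D \<longrightarrow> x \<in> interior D \<and> GDERIV b x :> G x"
    using assms(1) unfolding tame_def by blast
  show "ess_bounded_on D b"
    using b by (auto simp: ess_bounded_on_def intro!: measurable_restrict_space1 measurable_completion)
  define h where "h n = inverse (real (Suc n))" for n
  have h: "h \<longlonglongrightarrow> 0" "h n \<noteq> 0" "h n > 0" for n
    using LIMSEQ_inverse_real_of_nat by (auto simp: h_def[abs_def])
  define s where "s i n x = (b (x + h n *\<^sub>R i) - b x) / h n" for i :: "real^2" and n x
  have [measurable]: "b \<in> borel_measurable borel" by (rule b(1))
  have s_meas: "s i n \<in> borel_measurable lebesgue" for i n
  proof -
    have "s i n \<in> borel_measurable borel" unfolding s_def by measurable
    then show ?thesis by (simp add: measurable_completion)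
  qed
  have G_meas: "(\<lambda>x. if x \<in> D then G x else 0) \<in> borel_measurable lebesgue"
  proof (subst borel_measurable_euclidean_space, intro ballI)
    fix i :: "real^2" assume "i \<in> Basis"
    show "(\<lambda>x. (if x \<in> D then G x else 0) \<bullet> i) \<in> borel_measurable lebesgue"
    proof (rule borel_measurable_AE)
      \<comment> \<open>\<open>lim\<close> is a total function and measurable even where the
        quotients diverge, so it serves as a measurable version of the component of
        \<open>G\<close>.\<close>
      show "(\<lambda>x. if x \<in> D then lim (\<lambda>n. s i n x) else 0) \<in> borel_measurable lebesgue"
      proof (rule borel_measurable_if_I[OF _ D])
        show "(\<lambda>x. lim (\<lambda>n. s i n x)) \<in> borel_measurable (lebesgue_on D)"
          by (intro measurable_restrict_space1 borel_measurable_lim_metric s_meas)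
      qed
      show "AE x in lebesgue. (if x \<in> D then lim (\<lambda>n. s i n x) else 0) = (if x \<in> D then G x else 0) \<bullet> i"
        using AE
      proof eventually_elim
        case (elim x)
        then show ?case
          using limI[OF GDERIV_difference_quotient[OF _ h(1,2)], of b x "G x" i]
          by (auto simp: s_def inner_commute)
      qed
    qed
  qed
  have bound: "norm (G x) \<le> real DIM(real^2) * C" if x: "x \<in> interior D" "GDERIV b x :> G x" for x
  proof -
    have "\<bar>G x \<bullet> i\<bar> \<le> C" if i: "i \<in> Basis" for i
    proof -
      have "(\<lambda>n. s i n x) \<longlonglongrightarrow> i \<bullet> G x"
        unfolding s_def by (rule GDERIV_difference_quotient[OF x(2) h(1,2)])
      then have "(\<lambda>n. \<bar>s i n x\<bar>) \<longlonglongrightarrow> \<bar>i \<bullet> G x\<bar>"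
        by (rule tendsto_rabs)
      moreover have "eventually (\<lambda>n. \<bar>s i n x\<bar> \<le> C) sequentially"
      proof -
        obtain \<delta> where \<delta>: "\<delta> > 0" "ball x \<delta> \<subseteq> D"
          using x(1) mem_interior by blast
        have "eventually (\<lambda>n. h n < \<delta>) sequentially"
          using order_tendstoD(2)[OF h(1) \<delta>(1)] .
        then show ?thesis
        proof eventually_elim
          case (elim n)
          have d: "dist (x + h n *\<^sub>R i) x = h n"
            using i h(3)[of n] by (simp add: dist_norm)
          then have "x + h n *\<^sub>R i \<in> ball x \<delta>" "x \<in> ball x \<delta>"
            using elim \<delta>(1) by (auto simp: dist_commute)
          then have "closed_segment (x + h n *\<^sub>R i) x \<subseteq> D"
            by (meson \<delta>(2) closed_segment_subset convex_ball order_trans)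
          then show ?case
            using C d h(3)[of n] by (fastforce simp: s_def field_simps)
        qed
      qed
      ultimately have "\<bar>i \<bullet> G x\<bar> \<le> C"
        by (rule tendsto_upperbound) simp
      then show ?thesis by (simp add: inner_commute)
    qed
    then have "(\<Sum>i\<in>Basis. \<bar>G x \<bullet> i\<bar>) \<le> real (card (Basis :: (real^2) set)) * C"
      by (intro sum_bounded_above) auto
    then show ?thesis
      using norm_le_l1[of "G x"] by linarith
  qed
  have "AE x in lebesgue_on D. norm (G x) \<le> real DIM(real^2) * C"
  proof (subst AE_restrict_space_iff)
    show "AE x in lebesgue. x \<in> D \<longrightarrow> norm (G x) \<le> real DIM(real^2) * C"
      using AE by eventually_elim (use bound in blast)
  qed (use D in simp)
  then show "ess_bounded_on D G"
    using G_meas borel_measurable_if_D unfolding ess_bounded_on_def by blast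
qed

text \<open>Apply \<open>wedge_integral_eq_0\<close> to \<open>q = a \<phi>\<close>. The product
  rule splits \<open>rot (Gb x) . Gq x\<close> into the two integrands of the claim, and their sum
  integrates to 0.\<close>

lemma tame_product_weak_div:
  assumes a: "tame D a Ga" and b: "tame D b Gb" and "compact D" and \<phi>: "test_function (interior D) \<phi>"
  shows "(LINT x:interior D|lebesgue. (a x *\<^sub>R rot (Gb x)) \<bullet> grad \<phi> x)
       = - (LINT x:interior D|lebesgue. (Ga x \<bullet> rot (Gb x)) * \<phi> x)"
proof -
  let ?U = "interior D"
  let ?K = "closure {x. \<phi> x \<noteq> 0}"
  obtain A C where a: "a \<in> borel_measurable borel" "\<And>x. \<bar>a x\<bar> \<le> A"
    and C: "\<And>x y. closed_segment x y \<subseteq> D \<Longrightarrow> \<bar>a x - a y\<bar> \<le> C * dist x y"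
    and AEa: "AE x in lebesgue. x \<in> D \<longrightarrow> x \<in> ?U \<and> GDERIV a x :> Ga x"
    using assms(1) unfolding tame_def by blast
  obtain B C' where b: "b \<in> borel_measurable borel" "\<And>x. \<bar>b x\<bar> \<le> B"
    and C': "\<And>x y. closed_segment x y \<subseteq> D \<Longrightarrow> \<bar>b x - b y\<bar> \<le> C' * dist x y"
    and AEb: "AE x in lebesgue. x \<in> D \<longrightarrow> x \<in> ?U \<and> GDERIV b x :> Gb x"
    using assms(2) unfolding tame_def by blast
  obtain L where L: "0 \<le> L" "\<And>x. \<bar>\<phi> x\<bar> \<le> L" "\<And>x y. \<bar>\<phi> x - \<phi> y\<bar> \<le> L * dist x y"
    "continuous_on UNIV \<phi>" "\<And>x. GDERIV \<phi> x :> grad \<phi> x"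
    using test_function_bounds[OF \<phi>] by metis
  have K: "compact ?K" "?K \<subseteq> ?U"
    using \<phi> unfolding test_function_def by auto
  have [measurable]: "a \<in> borel_measurable borel" "\<phi> \<in> borel_measurable borel"
    using a(1) L(4) by (auto intro: borel_measurable_continuous_onI)
  define Gq where "Gq x = a x *\<^sub>R grad \<phi> x + \<phi> x *\<^sub>R Ga x" for x
  have A0: "0 \<le> A" using a(2)[of 0] by linarith
  have "(\<integral>x. indicator ?U x * (rot (Gb x) \<bullet> Gq x) \<partial>lebesgue) = 0"
  \<comment> \<open>The Lipschitz constant of \<open>a \<phi>\<close> comes from the product
    estimate. Absolute values are taken because \<open>C\<close> and \<open>C'\<close> are not known
    to be non-negative.\<close>
  proof (rule wedge_integral_eq_0[OF b, of "\<lambda>x. a x * \<phi> x" "A * L" ?K ?U "\<bar>C'\<bar>" "\<bar>C\<bar> * L + A * L"])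
    show "(\<lambda>x. a x * \<phi> x) \<in> borel_measurable borel" by measurable
    show "\<bar>a x * \<phi> x\<bar> \<le> A * L" for x
      unfolding abs_mult using a(2) L(2) A0 by (intro mult_mono) auto
    show "a x * \<phi> x = 0" if "x \<notin> ?K" for x
      using that closure_subset[of "{x. \<phi> x \<noteq> 0}"] by (subst mult_eq_0_iff) blast
    show "0 \<le> \<bar>C\<bar> * L + A * L" using L(1) A0 by simp
    show "\<bar>b x - b y\<bar> \<le> \<bar>C'\<bar> * dist x y" if "closed_segment x y \<subseteq> ?U" for x y
    proof -
      have "\<bar>b x - b y\<bar> \<le> C' * dist x y"
        using that C' interior_subset by (meson order_trans)
      also have "\<dots> \<le> \<bar>C'\<bar> * dist x y"
        by (intro mult_right_mono) auto
      finally show ?thesis .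
    qed
    show "\<bar>a x * \<phi> x - a y * \<phi> y\<bar> \<le> (\<bar>C\<bar> * L + A * L) * dist x y" if "closed_segment x y \<subseteq> ?U" for x y
    proof -
      have "\<bar>a x - a y\<bar> \<le> C * dist x y"
        using that C interior_subset by (meson order_trans)
      also have "\<dots> \<le> \<bar>C\<bar> * dist x y"
        by (intro mult_right_mono) auto
      finally have 1: "\<bar>(a x - a y) * \<phi> x\<bar> \<le> (\<bar>C\<bar> * dist x y) * L"
        unfolding abs_mult using L(2) by (intro mult_mono) auto
      have 2: "\<bar>a y * (\<phi> x - \<phi> y)\<bar> \<le> A * (L * dist x y)"
        unfolding abs_mult using a(2) L(3) A0 by (intro mult_mono) auto
      have "a x * \<phi> x - a y * \<phi> y = (a x - a y) * \<phi> x + a y * (\<phi> x - \<phi> y)"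
        by (simp add: algebra_simps)
      then have "\<bar>a x * \<phi> x - a y * \<phi> y\<bar> \<le> \<bar>(a x - a y) * \<phi> x\<bar> + \<bar>a y * (\<phi> x - \<phi> y)\<bar>"
        by simp
      then show ?thesis using 1 2 by (simp add: algebra_simps)
    qed
    show "AE x in lebesgue. x \<in> ?U \<longrightarrow> GDERIV b x :> Gb x \<and> GDERIV (\<lambda>x. a x * \<phi> x) x :> Gq x"
      using AEa AEb
    proof eventually_elim
      case (elim x)
      show ?case
      proof
        assume "x \<in> ?U"
        then have "x \<in> D" using interior_subset by blast
        then show "GDERIV b x :> Gb x \<and> GDERIV (\<lambda>x. a x * \<phi> x) x :> Gq x"
          using elim GDERIV_mult[OF _ L(5), of a x "Ga x"] by (simp add: Gq_def)
      qed
    qed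
  qed (use K in auto)
  then have "(LINT x:?U|lebesgue. (a x *\<^sub>R rot (Gb x)) \<bullet> grad \<phi> x + (Ga x \<bullet> rot (Gb x)) * \<phi> x) = 0"
    unfolding set_lebesgue_integral_def
    by (simp add: Gq_def inner_add_right inner_commute mult.commute)
  \<comment> \<open>Integrability of each summand is what permits splitting the vanishing
    integral.\<close>
  moreover have "set_integrable lebesgue ?U (\<lambda>x. (a x *\<^sub>R rot (Gb x)) \<bullet> grad \<phi> x)"
    using assms(1-3) by (intro ess_bounded_on_set_integrable ess_bounded_on_inner ess_bounded_on_scaleR
        ess_bounded_on_rot ess_bounded_on_test_function[OF \<phi>]) (auto intro: tame_imp_ess_bounded)
  moreover have "set_integrable lebesgue ?U (\<lambda>x. (Ga x \<bullet> rot (Gb x)) *\<^sub>R \<phi> x)"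
    using assms(1-3) by (intro ess_bounded_on_set_integrable ess_bounded_on_inner ess_bounded_on_scaleR
        ess_bounded_on_rot ess_bounded_on_test_function[OF \<phi>]) (auto intro: tame_imp_ess_bounded)
  ultimately show ?thesis
    by (simp add: set_integral_add)
qed

section \<open>Fields with bounded weak divergence and their span\<close>

text \<open>An \<open>L^\<infinity>\<close> analogue of \<open>Hdiv\<close>. It is a subspace
  containing all generators, so the span is handled here before passing to
  \<open>L^2\<close>.\<close>

definition bounded_div_fields :: "(real^2) set \<Rightarrow> (real^2 \<Rightarrow> real^2) set" where
  "bounded_div_fields D =
     {F. ess_bounded_on D F \<and> (\<exists>g. ess_bounded_on D g \<and> distributional_div (interior D) F g)}"

lemma bounded_div_fields_add:
  assumes "compact D" "F \<in> bounded_div_fields D" "F' \<in> bounded_div_fields D"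
  shows "F + F' \<in> bounded_div_fields D"
proof -
  obtain g g' where F: "ess_bounded_on D F" "ess_bounded_on D g" "distributional_div (interior D) F g"
    and F': "ess_bounded_on D F'" "ess_bounded_on D g'" "distributional_div (interior D) F' g'"
    using assms(2,3) unfolding bounded_div_fields_def by blast
  have "distributional_div (interior D) (F + F') (\<lambda>x. g x + g' x)"
    unfolding distributional_div_def
  proof (intro allI impI)
    fix \<phi> assume \<phi>: "test_function (interior D) \<phi>"
    have i: "set_integrable lebesgue (interior D) (\<lambda>x. H x \<bullet> grad \<phi> x)" if "ess_bounded_on D H" for H
      using assms(1) that by (intro ess_bounded_on_set_integrable ess_bounded_on_inner
          ess_bounded_on_test_function[OF \<phi>])
    have j: "set_integrable lebesgue (interior D) (\<lambda>x. k x * \<phi> x)" if "ess_bounded_on D k" for k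
      using assms(1) ess_bounded_on_set_integrable[OF assms(1)
          ess_bounded_on_inner[OF that ess_bounded_on_test_function(1)[OF \<phi>]]] by simp
    show "(LINT x:interior D|lebesgue. (F + F') x \<bullet> grad \<phi> x)
        = - (LINT x:interior D|lebesgue. (g x + g' x) * \<phi> x)"
      using F(3) F'(3) \<phi> unfolding distributional_div_def
      by (simp add: inner_add_left distrib_right set_integral_add i j F F')
  qed
  moreover have "ess_bounded_on D (F + F')"
    using ess_bounded_on_add[OF F(1) F'(1)] by (simp add: plus_fun_def)
  ultimately show ?thesis
    using ess_bounded_on_add[OF F(2) F'(2)] unfolding bounded_div_fields_def by blast
qed

lemma bounded_div_fields_scaleR:
  assumes "F \<in> bounded_div_fields D"
  shows "(\<lambda>x. c *\<^sub>R F x) \<in> bounded_div_fields D"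
proof -
  obtain g where F: "ess_bounded_on D F" "ess_bounded_on D g" "distributional_div (interior D) F g"
    using assms unfolding bounded_div_fields_def by blast
  have "distributional_div (interior D) (\<lambda>x. c *\<^sub>R F x) (\<lambda>x. c *\<^sub>R g x)"
    using F(3) unfolding distributional_div_def by (simp add: mult.assoc)
  then show ?thesis
    using ess_bounded_on_scaleR[OF ess_bounded_on_const F(1)]
      ess_bounded_on_scaleR[OF ess_bounded_on_const F(2)]
    unfolding bounded_div_fields_def by blast
qed

text \<open>\<open>field_span\<close> is built from a bare scaling function, so the general facts
  about spans become available only through this instance.\<close>

lemma module_fields: "module (\<lambda>(c::real) (F :: 'a \<Rightarrow> 'b::real_vector) x. c *\<^sub>R F x)"
  by unfold_locales (auto simp: fun_eq_iff algebra_simps)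

lemma field_span_subset_bounded_div_fields:
  assumes "compact D" "S \<subseteq> bounded_div_fields D"
  shows "field_span S \<subseteq> bounded_div_fields D"
proof -
  have "ess_bounded_on D (\<lambda>x. 0 :: real^2)" "ess_bounded_on D (\<lambda>x. 0 :: real)"
    by (rule ess_bounded_on_const)+
  moreover have "distributional_div (interior D) (\<lambda>x. 0) (\<lambda>x. 0)"
    by (simp add: distributional_div_def)
  ultimately have "(\<lambda>x. 0) \<in> bounded_div_fields D"
    unfolding bounded_div_fields_def by blast
  then have "module.subspace (\<lambda>(c::real) F x. c *\<^sub>R F x) (bounded_div_fields D)"
    unfolding module.subspace_def[OF module_fields]
    using bounded_div_fields_add[OF assms(1)] bounded_div_fields_scaleR
    unfolding zero_fun_def by blast
  then show ?thesis
    unfolding field_span_def using assms(2) by (intro module.span_minimal[OF module_fields])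
qed

lemma bounded_div_fields_subset_Hdiv:
  assumes "compact (\<Union>M)"
  shows "bounded_div_fields (\<Union>M) \<subseteq> Hdiv M"
proof
  fix F assume "F \<in> bounded_div_fields (\<Union>M)"
  then obtain g where "ess_bounded_on (\<Union>M) F" "ess_bounded_on (\<Union>M) g"
    "distributional_div (interior (\<Union>M)) F g"
    unfolding bounded_div_fields_def by blast
  then have "L2_on (\<Union>M) F" "L2_on (\<Union>M) g" "distributional_div (interior (\<Union>M)) F g"
    by (simp_all only: ess_bounded_on_imp_L2[OF assms])
  then show "F \<in> Hdiv M"
    unfolding Hdiv_def by blast
qed

theorem mainTheorem2:
  fixes M :: "(real^2) set set"
    and v :: "nat \<Rightarrow> real^2" and p :: nat
    and lam :: "(real^2) set \<Rightarrow> real^2 \<Rightarrow> real^2 \<Rightarrow> real"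
    and u :: "real^2 \<Rightarrow> real^2"
  assumes mesh: "polygonal_mesh M"
    and ordering: "bij_betw v {1..p} (mesh_vertices M)"
    and coords: "\<And>m. m \<in> M \<Longrightarrow> gen_barycentric m (lam m)"
    and regular: "\<And>m w. m \<in> M \<Longrightarrow> w \<in> vertices m \<Longrightarrow> lipschitz_regular_on m (lam m w)"
    and u: "u \<in> field_span {(\<lambda>x. rot (hat M lam (v i) x *\<^sub>R grad (hat M lam (v j)) x)) | i j.
               i \<in> {1..p} \<and> j \<in> {1..p} \<and> (\<exists>m\<in>M. v i \<in> vertices m \<and> v j \<in> vertices m)}"
  shows "u \<in> Hdiv M"
proof -
  let ?D = "\<Union>M"
  have comp: "compact ?D"
    using mesh by (auto simp: polygonal_mesh_def convex_polygon_def polytope_imp_compact)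
  \<comment> \<open>The cut-off matches \<open>tame_hat\<close>. It changes nothing on the mesh,
    where all the integrals live.\<close>
  define h where "h w x = (if x \<in> ?D then hat M lam w x else 0)" for w x
  have tame: "tame ?D (h w) (grad (hat M lam w))" for w
    unfolding h_def using tame_hat[OF mesh coords regular] .
  note bounded = tame_imp_ess_bounded[OF tame comp]
  have "(\<lambda>x. rot (hat M lam y x *\<^sub>R grad (hat M lam z) x)) \<in> bounded_div_fields ?D" for y z
  proof -
    have eq: "rot (hat M lam y x *\<^sub>R grad (hat M lam z) x) = h y x *\<^sub>R rot (grad (hat M lam z) x)"
      if "x \<in> ?D" for x
      using that linear_scale[OF linear_rot] by (simp add: h_def)
    have "ess_bounded_on ?D (\<lambda>x. h y x *\<^sub>R rot (grad (hat M lam z) x))"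
      by (intro ess_bounded_on_scaleR ess_bounded_on_rot bounded)
    then have "ess_bounded_on ?D (\<lambda>x. rot (hat M lam y x *\<^sub>R grad (hat M lam z) x))"
      using ess_bounded_on_cong eq by (metis (no_types, lifting))
    \<comment> \<open>The candidate divergence is the one term left by the product rule, as the
      divergence of a rotated gradient vanishes.\<close>
    moreover have "ess_bounded_on ?D (\<lambda>x. grad (hat M lam y) x \<bullet> rot (grad (hat M lam z) x))"
      by (intro ess_bounded_on_inner ess_bounded_on_rot bounded)
    moreover have "distributional_div (interior ?D) (\<lambda>x. rot (hat M lam y x *\<^sub>R grad (hat M lam z) x))
        (\<lambda>x. grad (hat M lam y) x \<bullet> rot (grad (hat M lam z) x))"
      unfolding distributional_div_def
    proof (intro allI impI)
      fix \<phi> assume \<phi>: "test_function (interior ?D) \<phi>"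
      have "(LINT x:interior ?D|lebesgue. rot (hat M lam y x *\<^sub>R grad (hat M lam z) x) \<bullet> grad \<phi> x)
          = (LINT x:interior ?D|lebesgue. (h y x *\<^sub>R rot (grad (hat M lam z) x)) \<bullet> grad \<phi> x)"
      proof (rule set_lebesgue_integral_cong)
        show "\<forall>x. x \<in> interior ?D \<longrightarrow> rot (hat M lam y x *\<^sub>R grad (hat M lam z) x) \<bullet> grad \<phi> x
            = (h y x *\<^sub>R rot (grad (hat M lam z) x)) \<bullet> grad \<phi> x"
          using eq interior_subset[of ?D] by (metis subsetD)
      qed simp
      also have "\<dots> = - (LINT x:interior ?D|lebesgue.
          (grad (hat M lam y) x \<bullet> rot (grad (hat M lam z) x)) * \<phi> x)"
        by (rule tame_product_weak_div[OF tame tame comp \<phi>])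
      finally show "(LINT x:interior ?D|lebesgue. rot (hat M lam y x *\<^sub>R grad (hat M lam z) x) \<bullet> grad \<phi> x)
          = - (LINT x:interior ?D|lebesgue. (grad (hat M lam y) x \<bullet> rot (grad (hat M lam z) x)) * \<phi> x)" .
    qed
    ultimately show ?thesis
      unfolding bounded_div_fields_def by blast
  qed
  then have "field_span {(\<lambda>x. rot (hat M lam (v i) x *\<^sub>R grad (hat M lam (v j)) x)) | i j.
      i \<in> {1..p} \<and> j \<in> {1..p} \<and> (\<exists>m\<in>M. v i \<in> vertices m \<and> v j \<in> vertices m)} \<subseteq> bounded_div_fields ?D"
    by (intro field_span_subset_bounded_div_fields[OF comp]) blast
  then show ?thesis
    using u bounded_div_fields_subset_Hdiv[OF comp] by blast
qed

end
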